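(* Let $n\ge 3$ and let $M$ be a non-degenerate hypersurface in $\mathbb{A}^{n+1}$ with Blaschke-Berwald metric $h$ and affine shape operator $\mathcal{S}$; put $S(X,Y)=h(X,\mathcal{S}Y)$, and let $R^{\ast}=\frac12\,S\wedge S$ be the Opozda-Verstraelen affine curvature tensor of $M$. If there are functions $L$ and $L_1$ on $M$ such that $$S^{2}+L_{1}\,S+L\,h=0$$ on $M$, then $$R^{\ast}\cdot R^{\ast}=L\,Q(h,R^{\ast})$$ on $M$.
   Context: $\mathbb{A}^{n+1}$ is $\mathbb{R}^{n+1}$ with its standard flat connection and the volume form given by the determinant. A hypersurface $M\subset\mathbb{A}^{n+1}$ (connected, smooth) is non-degenerate if its affine fundamental form is non-degenerate; it then carries its affine normal $\xi$, the Blaschke-Berwald metric $h$ (a semi-Riemannian metric), the induced connection $\nabla$ and the affine shape operator $\mathcal{S}$ (Gauss and Weingarten formulas $\widetilde\nabla_XY=\nabla_XY+h(X,Y)\xi$, $\widetilde\nabla_X\xi=-\mathcal{S}X$); the operator $\mathcal{S}$ is $h$-self-adjoint: $h(X,\mathcal{S}Y)=h(Y,\mathcal{S}X)$. Set $S(X,Y)=h(X,\mathcal{S}Y)$ and $S^{p}(X,Y)=h(X,\mathcal{S}^{p}Y)$. For symmetric $(0,2)$-tensors $E,F$ the Kulkarni-Nomizu product is $(E\wedge F)(X_1,X_2,X_3,X_4)=E(X_1,X_4)F(X_2,X_3)+E(X_2,X_3)F(X_1,X_4)-E(X_1,X_3)F(X_2,X_4)-E(X_2,X_4)F(X_1,X_3)$.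 The Opozda-Verstraelen affine curvature tensor is $R^{\ast}=\frac12 S\wedge S$, i.e. $R^{\ast}(X_1,\dots,X_4)=S(X_1,X_4)S(X_2,X_3)-S(X_1,X_3)S(X_2,X_4)$. For a $(0,4)$-tensor $B$ with the algebraic symmetries of a curvature tensor, let $\mathcal{B}(X,Y)$ be the endomorphism with $h(\mathcal{B}(X_1,X_2)X_3,X_4)=B(X_1,X_2,X_3,X_4)$. For a $(0,k)$-tensor $T$, $(B\cdot T)(X_1,\dots,X_k,X,Y)=-\sum_{i=1}^{k}T(X_1,\dots,\mathcal{B}(X,Y)X_i,\dots,X_k)$. For a symmetric $(0,2)$-tensor $A$, let $(X\wedge_AY)Z=A(Y,Z)X-A(X,Z)Y$ and $Q(A,T)(X_1,\dots,X_k,X,Y)=-\sum_{i=1}^{k}T(X_1,\dots,(X\wedge_AY)X_i,\dots,X_k)$. *)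

theory Defs
  imports "HOL-Analysis.Analysis"
begin

section \<open>Smooth maps on open subsets of a Euclidean space\<close>

fun Ck_on :: "nat \<Rightarrow> 'a::euclidean_space set \<Rightarrow> ('a \<Rightarrow> 'b::real_normed_vector) \<Rightarrow> bool" where
  "Ck_on 0 U F \<longleftrightarrow> continuous_on U F"
| "Ck_on (Suc k) U F \<longleftrightarrow> (\<forall>u\<in>U. F differentiable (at u)) \<and>
     (\<forall>a. Ck_on k U (\<lambda>u. frechet_derivative F (at u) a))"

definition smooth_on :: "'a::euclidean_space set \<Rightarrow> ('a \<Rightarrow> 'b::real_normed_vector) \<Rightarrow> bool" where
  "smooth_on U F \<longleftrightarrow> (\<forall>k. Ck_on k U F)"


section \<open>Hypersurfaces\<close>

text \<open>The dimension of the hypersurface is the cardinality n of the index type, and the ambient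
  affine space has the index type extended by one element, hence dimension n + 1.

  A hypersurface is a connected subset \<open>M\<close> of a Hausdorff space together with an immersion
  \<open>f\<close> of \<open>M\<close> into the affine space. A subset of the affine space is the case where \<open>f\<close> is the
  identity. No atlas is carried along: the smooth structure for which \<open>f\<close> is an immersion is
  determined by \<open>f\<close> and the topology of \<open>M\<close>, and its inverse charts are the
  parametrizations below.\<close>

type_synonym 'n affine_space = "(real, 'n option) vec"

definition local_parametrization ::
  "'p::t2_space set \<Rightarrow> ('p \<Rightarrow> 'n::finite affine_space) \<Rightarrow> (real^'n) set \<Rightarrow> (real^'n \<Rightarrow> 'p) \<Rightarrow> bool" where
  "local_parametrization M f U x \<longleftrightarrow>
     open U \<and> openin (top_of_set M) (x ` U) \<and> (\<exists>y. homeomorphism U (x ` U) x y) \<and>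
     smooth_on U (f \<circ> x) \<and> (\<forall>u\<in>U. inj (frechet_derivative (f \<circ> x) (at u)))"

definition hypersurface :: "'p::t2_space set \<Rightarrow> ('p \<Rightarrow> 'n::finite affine_space) \<Rightarrow> bool" where
  "hypersurface M f \<longleftrightarrow>
     connected M \<and> (\<forall>p\<in>M. \<exists>U x. local_parametrization M f U x \<and> p \<in> x ` U)"

text \<open>Tangent vectors are identified with their images under the differential of \<open>f\<close>.\<close>

definition tangent_space ::
  "'p::t2_space set \<Rightarrow> ('p \<Rightarrow> 'n::finite affine_space) \<Rightarrow> 'p \<Rightarrow> 'n affine_space set" where
  "tangent_space M f p =
     {v. \<exists>U x u. local_parametrization M f U x \<and> u \<in> U \<and> x u = p \<and>
           v \<in> range (frechet_derivative (f \<circ> x) (at u))}"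

text \<open>Changes of parametrization are smooth, so it does not matter in which parametrization around
  a point smoothness is tested, or a directional derivative computed.\<close>

definition smooth_along ::
  "'p::t2_space set \<Rightarrow> ('p \<Rightarrow> 'n::finite affine_space) \<Rightarrow> 'p set \<Rightarrow> ('p \<Rightarrow> 'n affine_space) \<Rightarrow> bool" where
  "smooth_along M f V W \<longleftrightarrow>
     (\<forall>q\<in>V. \<exists>U x. local_parametrization M f U x \<and> q \<in> x ` U \<and> x ` U \<subseteq> V \<and> smooth_on U (W \<circ> x))"

text \<open>The derivative of \<open>W\<close> at \<open>p\<close> in the direction of the tangent vector \<open>v\<close>, with respect to the
  standard flat connection of the affine space.\<close>

definition flat_derivative ::
  "'p::t2_space set \<Rightarrow> ('p \<Rightarrow> 'n::finite affine_space) \<Rightarrow> ('p \<Rightarrow> 'n affine_space) \<Rightarrow>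
     'p \<Rightarrow> 'n affine_space \<Rightarrow> 'n affine_space" where
  "flat_derivative M f W p v =
     (THE w. \<exists>U x u a. local_parametrization M f U x \<and> u \<in> U \<and> x u = p \<and>
        frechet_derivative (f \<circ> x) (at u) a = v \<and> frechet_derivative (W \<circ> x) (at u) a = w)"

definition tangent_field ::
  "'p::t2_space set \<Rightarrow> ('p \<Rightarrow> 'n::finite affine_space) \<Rightarrow> 'p set \<Rightarrow> ('p \<Rightarrow> 'n affine_space) \<Rightarrow> bool" where
  "tangent_field M f V Y \<longleftrightarrow>
     openin (top_of_set M) V \<and> smooth_along M f V Y \<and> (\<forall>q\<in>V. Y q \<in> tangent_space M f q)"

definition transversal_field ::
  "'p::t2_space set \<Rightarrow> ('p \<Rightarrow> 'n::finite affine_space) \<Rightarrow> 'p set \<Rightarrow> ('p \<Rightarrow> 'n affine_space) \<Rightarrow> bool" where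
  "transversal_field M f V \<xi> \<longleftrightarrow>
     openin (top_of_set M) V \<and> smooth_along M f V \<xi> \<and> (\<forall>q\<in>V. \<xi> q \<notin> tangent_space M f q)"


section \<open>Gauss and Weingarten formulas, affine normal\<close>

text \<open>Gauss formula: for tangent fields, the flat derivative of \<open>Y\<close> along \<open>X\<close> minus
  \<open>h(X,Y)\<close> times \<open>\<xi>\<close> is tangent (this tangent part is the induced connection). The value of
  \<open>h(X,Y)\<close> at \<open>p\<close> only depends on the values of the fields at \<open>p\<close>, whence the quantification over
  all local extensions \<open>W\<close> of the tangent vector \<open>Y\<close>.\<close>

definition affine_fundamental_form ::
  "'p::t2_space set \<Rightarrow> ('p \<Rightarrow> 'n::finite affine_space) \<Rightarrow> ('p \<Rightarrow> 'n affine_space) \<Rightarrow>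
     'p \<Rightarrow> 'n affine_space \<Rightarrow> 'n affine_space \<Rightarrow> real" where
  "affine_fundamental_form M f \<xi> p X Y =
     (THE c. \<forall>V W. tangent_field M f V W \<and> p \<in> V \<and> W p = Y \<longrightarrow>
        flat_derivative M f W p X - c *\<^sub>R \<xi> p \<in> tangent_space M f p)"

text \<open>Non-degeneracy does not depend on the transversal field, as another choice of it rescales the
  affine fundamental form by a nowhere vanishing function.\<close>

definition nondegenerate_hypersurface ::
  "'p::t2_space set \<Rightarrow> ('p \<Rightarrow> 'n::finite affine_space) \<Rightarrow> bool" where
  "nondegenerate_hypersurface M f \<longleftrightarrow> hypersurface M f \<and>
     (\<forall>V \<xi>. transversal_field M f V \<xi> \<longrightarrow>
        (\<forall>p\<in>V. \<forall>X\<in>tangent_space M f p.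
           (\<forall>Y\<in>tangent_space M f p. affine_fundamental_form M f \<xi> p X Y = 0) \<longrightarrow> X = 0))"

text \<open>The volume form induced by \<open>\<xi>\<close>: the determinant of the n tangent vectors and \<open>\<xi>\<close>. Its sign
  depends on an ordering of the indices; only its absolute value is used.\<close>

definition induced_volume :: "'n::finite affine_space \<Rightarrow> ('n \<Rightarrow> 'n affine_space) \<Rightarrow> real" where
  "induced_volume \<nu> X = det (\<chi> i. case i of Some j \<Rightarrow> X j | None \<Rightarrow> \<nu>)"

text \<open>The affine normal is the transversal field, unique up to sign, that is equiaffine (its
  derivatives are tangent, equivalently the induced volume form is parallel for the induced
  connection) and whose induced volume form is up to orientation the volume form of its affine
  fundamental form.\<close>

definition affine_normal ::
  "'p::t2_space set \<Rightarrow> ('p \<Rightarrow> 'n::finite affine_space) \<Rightarrow> ('p \<Rightarrow> 'n affine_space) \<Rightarrow> bool" where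
  "affine_normal M f \<xi> \<longleftrightarrow> transversal_field M f M \<xi> \<and>
     (\<forall>p\<in>M. \<forall>X\<in>tangent_space M f p. flat_derivative M f \<xi> p X \<in> tangent_space M f p) \<and>
     (\<forall>p\<in>M. \<forall>X. (\<forall>i. X i \<in> tangent_space M f p) \<longrightarrow>
        \<bar>induced_volume (\<xi> p) X\<bar> =
          sqrt \<bar>det (\<chi> i j. affine_fundamental_form M f \<xi> p (X i) (X j))\<bar>)"

text \<open>For the affine normal, the following are the Blaschke-Berwald metric and (by the Weingarten
  formula) the affine shape operator.\<close>

abbreviation blaschke_metric ::
  "'p::t2_space set \<Rightarrow> ('p \<Rightarrow> 'n::finite affine_space) \<Rightarrow> ('p \<Rightarrow> 'n affine_space) \<Rightarrow>
     'p \<Rightarrow> 'n affine_space \<Rightarrow> 'n affine_space \<Rightarrow> real" where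
  "blaschke_metric \<equiv> affine_fundamental_form"

definition shape_operator ::
  "'p::t2_space set \<Rightarrow> ('p \<Rightarrow> 'n::finite affine_space) \<Rightarrow> ('p \<Rightarrow> 'n affine_space) \<Rightarrow>
     'p \<Rightarrow> 'n affine_space \<Rightarrow> 'n affine_space" where
  "shape_operator M f \<xi> p X = - flat_derivative M f \<xi> p X"

definition shape_form ::
  "nat \<Rightarrow> 'p::t2_space set \<Rightarrow> ('p \<Rightarrow> 'n::finite affine_space) \<Rightarrow> ('p \<Rightarrow> 'n affine_space) \<Rightarrow>
     'p \<Rightarrow> 'n affine_space \<Rightarrow> 'n affine_space \<Rightarrow> real" where
  "shape_form k M f \<xi> p X Y = blaschke_metric M f \<xi> p X ((shape_operator M f \<xi> p ^^ k) Y)"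


section \<open>Tensor operations on one tangent space\<close>

type_synonym 'v tensor2 = "'v \<Rightarrow> 'v \<Rightarrow> real"
type_synonym 'v tensor4 = "'v \<Rightarrow> 'v \<Rightarrow> 'v \<Rightarrow> 'v \<Rightarrow> real"
type_synonym 'v tensor6 = "'v \<Rightarrow> 'v \<Rightarrow> 'v \<Rightarrow> 'v \<Rightarrow> 'v \<Rightarrow> 'v \<Rightarrow> real"

definition kulkarni_nomizu :: "'v tensor2 \<Rightarrow> 'v tensor2 \<Rightarrow> 'v tensor4" where
  "kulkarni_nomizu E F X1 X2 X3 X4 =
     E X1 X4 * F X2 X3 + E X2 X3 * F X1 X4 - E X1 X3 * F X2 X4 - E X2 X4 * F X1 X3"

definition derivation_action :: "('v \<Rightarrow> 'v) \<Rightarrow> 'v tensor4 \<Rightarrow> 'v tensor4" where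
  "derivation_action D T X1 X2 X3 X4 =
     - (T (D X1) X2 X3 X4 + T X1 (D X2) X3 X4 + T X1 X2 (D X3) X4 + T X1 X2 X3 (D X4))"

text \<open>The endomorphism of the tangent space \<open>V\<close> that the metric \<open>h\<close> associates with \<open>B\<close>.\<close>

definition curvature_endo :: "'v set \<Rightarrow> 'v tensor2 \<Rightarrow> 'v tensor4 \<Rightarrow> 'v \<Rightarrow> 'v \<Rightarrow> 'v \<Rightarrow> 'v" where
  "curvature_endo V h B X Y Z = (THE W. W \<in> V \<and> (\<forall>X4\<in>V. h W X4 = B X Y Z X4))"

definition curvature_dot :: "'v set \<Rightarrow> 'v tensor2 \<Rightarrow> 'v tensor4 \<Rightarrow> 'v tensor4 \<Rightarrow> 'v tensor6" where
  "curvature_dot V h B T X1 X2 X3 X4 X Y =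
     derivation_action (curvature_endo V h B X Y) T X1 X2 X3 X4"

definition wedge_endo :: "'v::real_vector tensor2 \<Rightarrow> 'v \<Rightarrow> 'v \<Rightarrow> 'v \<Rightarrow> 'v" where
  "wedge_endo A X Y Z = A Y Z *\<^sub>R X - A X Z *\<^sub>R Y"

definition tachibana :: "'v::real_vector tensor2 \<Rightarrow> 'v tensor4 \<Rightarrow> 'v tensor6" where
  "tachibana A T X1 X2 X3 X4 X Y = derivation_action (wedge_endo A X Y) T X1 X2 X3 X4"

definition opozda_verstraelen ::
  "'p::t2_space set \<Rightarrow> ('p \<Rightarrow> 'n::finite affine_space) \<Rightarrow> ('p \<Rightarrow> 'n affine_space) \<Rightarrow>
     'p \<Rightarrow> 'n affine_space tensor4" where
  "opozda_verstraelen M f \<xi> p X1 X2 X3 X4 =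
     1/2 * kulkarni_nomizu (shape_form 1 M f \<xi> p) (shape_form 1 M f \<xi> p) X1 X2 X3 X4"

end

theory Submission
  imports Defs
begin

text \<open>Since \<open>h\<close> is non-degenerate and \<open>\<S>\<close> is self-adjoint, the endomorphism of \<open>R\<^sup>*\<close> is
  \<open>Z \<mapsto> S(Y,Z) \<S>X - S(X,Z) \<S>Y\<close>. Applying \<open>S\<close> to it produces \<open>S\<^sup>2 = - L\<^sub>1 S - L h\<close>; in
  \<open>R\<^sup>* \<cdot> R\<^sup>*\<close> the terms with \<open>L\<^sub>1\<close> cancel and those with \<open>L\<close> give \<open>L Q(h,R\<^sup>*)\<close>.
  In a local parametrization \<open>x\<close>, the symmetry of \<open>h\<close> and the self-adjointness of \<open>\<S>\<close> are the
  symmetry of the second derivatives of \<open>f \<circ> x\<close> and \<open>\<xi> \<circ> x\<close> modulo tangent vectors.\<close>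

section \<open>Derivatives\<close>

text \<open>The second difference is the increment over [0,t] of G(p + s a + t b) - G(p + s a) as a
  function of s. The mean value theorem turns it into t times a difference of two values of
  \<open>\<lambda>u. G' u a\<close>, and the first-order expansion of that map at \<open>p\<close>
  evaluates this difference as t times \<open>H b\<close> up to o(t).\<close>

lemma second_difference_tendsto:
  fixes G :: "'a::real_normed_vector \<Rightarrow> real"
  assumes U: "open U" "p \<in> U"
    and G: "\<And>u. u \<in> U \<Longrightarrow> (G has_derivative G' u) (at u)"
    and H: "((\<lambda>u. G' u a) has_derivative H) (at p)"
  shows "((\<lambda>t. (G (p + t *\<^sub>R a + t *\<^sub>R b) - G (p + t *\<^sub>R a) - G (p + t *\<^sub>R b) + G p) / t\<^sup>2)
     \<longlongrightarrow> H b) (at_right 0)"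
proof (rule tendstoI)
  fix e :: real assume e: "e > 0"
  \<comment> \<open>\<open>K\<close> exceeds the factor 2 (|a| + |b|) of the final error estimate;
    the summand 1 keeps it positive when both directions vanish.\<close>
  define K where "K = 2 * (norm a + norm b) + 1"
  have K: "K > 0" unfolding K_def by (simp add: add_nonneg_pos)
  define e' where "e' = e / (2 * K)"
  have e': "e' > 0" unfolding e'_def using e K by simp
  interpret H: bounded_linear H using H by (rule has_derivative_bounded_linear)
  obtain d1 where d1: "d1 > 0" "\<And>y. norm (y - p) < d1 \<Longrightarrow>
      \<bar>G' y a - G' p a - H (y - p)\<bar> \<le> e' * norm (y - p)"
    using H e' unfolding has_derivative_at_alt real_norm_def by blast
  obtain d2 where d2: "d2 > 0" "ball p d2 \<subseteq> U" using U openE by blast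
  define d where "d = min d1 d2 / K"
  have d: "d > 0" unfolding d_def using d1 d2 K by simp
  have est: "dist ((G (p + t *\<^sub>R a + t *\<^sub>R b) - G (p + t *\<^sub>R a) - G (p + t *\<^sub>R b) + G p) / t\<^sup>2) (H b) < e"
    if t: "0 < t" "t < d" for t
  proof -
    have tK: "t * K < d1" "t * K < d2"
      using t(2) K unfolding d_def by (simp_all add: pos_less_divide_eq)
    have near: "norm (s *\<^sub>R a + r *\<^sub>R b) \<le> t * (norm a + norm b)" if "0 \<le> s" "s \<le> t" "0 \<le> r" "r \<le> t" for s r
    proof -
      have "norm (s *\<^sub>R a + r *\<^sub>R b) \<le> s * norm a + r * norm b"
        using norm_triangle_ineq[of "s *\<^sub>R a" "r *\<^sub>R b"] that by simp
      also have "\<dots> \<le> t * norm a + t * norm b"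
        using that by (intro add_mono mult_right_mono) auto
      finally show ?thesis by (simp add: algebra_simps)
    qed
    have tK': "t * (norm a + norm b) \<le> t * K"
      using t(1) unfolding K_def by (intro mult_left_mono) (auto simp: add_nonneg_nonneg)
    have inU: "p + (s *\<^sub>R a + r *\<^sub>R b) \<in> U" if "0 \<le> s" "s \<le> t" "0 \<le> r" "r \<le> t" for s r
    proof -
      have "dist p (p + (s *\<^sub>R a + r *\<^sub>R b)) < d2"
        using near[OF that] tK' tK(2) unfolding dist_norm norm_minus_commute[of p] by simp
      then show ?thesis using d2(2) by auto
    qed
    \<comment> \<open>\<open>\<phi> t - \<phi> 0\<close> is the numerator of the quotient. The term
      \<open>0 *\<^sub>R b\<close> is kept so that both summands are instances, r = t and r = 0, of
      one formula in r.\<close>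
    define \<phi> where "\<phi> s = G (p + (s *\<^sub>R a + t *\<^sub>R b)) - G (p + (s *\<^sub>R a + 0 *\<^sub>R b))" for s
    have d\<phi>: "(\<phi> has_derivative (\<lambda>k. G' (p + (s *\<^sub>R a + t *\<^sub>R b)) (k *\<^sub>R a) - G' (p + (s *\<^sub>R a + 0 *\<^sub>R b)) (k *\<^sub>R a)))
        (at s within {0..t})" if "0 \<le> s" "s \<le> t" for s
    proof -
      have line: "((\<lambda>s. G (p + (s *\<^sub>R a + r *\<^sub>R b))) has_derivative (\<lambda>k. G' (p + (s *\<^sub>R a + r *\<^sub>R b)) (k *\<^sub>R a)))
          (at s within {0..t})" if r: "0 \<le> r" "r \<le> t" for r
      proof -
        have "((\<lambda>s. p + (s *\<^sub>R a + r *\<^sub>R b)) has_derivative (\<lambda>k. k *\<^sub>R a)) (at s within {0..t})"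
          by (auto intro!: derivative_eq_intros)
        from has_derivative_compose[OF this G[OF inU[OF \<open>0 \<le> s\<close> \<open>s \<le> t\<close> r]]] show ?thesis .
      qed
      show ?thesis unfolding \<phi>_def
        by (intro has_derivative_diff line) (use t in auto)
    qed
    \<comment> \<open>The mean value theorem is applied to the difference of the two terms, so both
      share the same \<open>s\<close> and their contributions \<open>H (s *\<^sub>R a)\<close>
      cancel.\<close>
    obtain s where s: "s \<in> {0<..<t}"
      and ms: "\<phi> t - \<phi> 0 = G' (p + (s *\<^sub>R a + t *\<^sub>R b)) ((t - 0) *\<^sub>R a) - G' (p + (s *\<^sub>R a + 0 *\<^sub>R b)) ((t - 0) *\<^sub>R a)"
      using mvt_simple[OF t(1) d\<phi>] by blast
    define g where "g r = G' (p + (s *\<^sub>R a + r *\<^sub>R b)) a" for r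
    have sc: "G' (p + (s *\<^sub>R a + r *\<^sub>R b)) (t *\<^sub>R a) = t * g r" if "0 \<le> r" "r \<le> t" for r
    proof -
      have "bounded_linear (G' (p + (s *\<^sub>R a + r *\<^sub>R b)))"
        by (rule has_derivative_bounded_linear, rule G, rule inU) (use s that in auto)
      then show ?thesis unfolding g_def by (simp add: linear_simps)
    qed
    have ms': "\<phi> t - \<phi> 0 = t * (g t - g 0)"
      using ms sc[of t] sc[of 0] t by (simp add: right_diff_distrib)
    have g: "\<bar>g r - G' p a - H (s *\<^sub>R a + r *\<^sub>R b)\<bar> \<le> e' * (t * (norm a + norm b))" if "0 \<le> r" "r \<le> t" for r
    proof -
      have n: "norm (s *\<^sub>R a + r *\<^sub>R b) \<le> t * (norm a + norm b)"
        by (rule near) (use s that in auto)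
      have "\<bar>g r - G' p a - H (s *\<^sub>R a + r *\<^sub>R b)\<bar> \<le> e' * norm (s *\<^sub>R a + r *\<^sub>R b)"
        using d1(2)[of "p + (s *\<^sub>R a + r *\<^sub>R b)"] n tK' tK unfolding g_def by simp
      also have "\<dots> \<le> e' * (t * (norm a + norm b))"
        using n e' by (intro mult_left_mono) auto
      finally show ?thesis .
    qed
    have Hr: "H (s *\<^sub>R a + t *\<^sub>R b) = H (s *\<^sub>R a) + t * H b" "H (s *\<^sub>R a + 0 *\<^sub>R b) = H (s *\<^sub>R a)"
      by (simp_all add: H.add H.scaleR)
    have "\<bar>g t - g 0 - t * H b\<bar> \<le> 2 * (e' * (t * (norm a + norm b)))"
      using g[of t] g[of 0] t unfolding Hr by linarith
    also have "\<dots> = t * (e' * (2 * (norm a + norm b)))" by simp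
    also have "\<dots> \<le> t * (e' * K)"
      using t e' unfolding K_def by (intro mult_left_mono) auto
    also have "\<dots> = t * (e / 2)" unfolding e'_def using K by simp
    also have "\<dots> < t * e" using t e by simp
    finally have lt: "\<bar>g t - g 0 - t * H b\<bar> < t * e" .
    have "(\<phi> t - \<phi> 0) / t\<^sup>2 - H b = (g t - g 0 - t * H b) / t"
      unfolding ms' using t by (simp add: field_simps power2_eq_square)
    then have "\<bar>(\<phi> t - \<phi> 0) / t\<^sup>2 - H b\<bar> < e"
      using lt t by (simp add: abs_divide pos_divide_less_eq mult.commute)
    then show ?thesis by (simp add: dist_real_def \<phi>_def algebra_simps)
  qed
  show "\<forall>\<^sub>F t in at_right 0. dist ((G (p + t *\<^sub>R a + t *\<^sub>R b) - G (p + t *\<^sub>R a) - G (p + t *\<^sub>R b) + G p) / t\<^sup>2) (H b) < e"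
    unfolding eventually_at_right_field using d est by auto
qed

text \<open>Both iterated derivatives are limits of the same second difference quotient, which is
  symmetric in the two directions.\<close>

lemma second_derivative_symmetric:
  fixes F :: "'a::real_normed_vector \<Rightarrow> 'b::real_inner"
  assumes U: "open U" "p \<in> U"
    and F: "\<And>u. u \<in> U \<Longrightarrow> (F has_derivative F' u) (at u)"
    and A: "((\<lambda>u. F' u a) has_derivative A) (at p)"
    and B: "((\<lambda>u. F' u b) has_derivative B) (at p)"
  shows "A b = B a"
proof -
  \<comment> \<open>Pairing with an arbitrary vector reduces the claim to real-valued maps, where
    the mean value theorem is available.\<close>
  have eq: "v \<bullet> A b = v \<bullet> B a" for v
  proof -
    let ?q = "\<lambda>a b t. (v \<bullet> F (p + t *\<^sub>R a + t *\<^sub>R b) - v \<bullet> F (p + t *\<^sub>R a) - v \<bullet> F (p + t *\<^sub>R b) + v \<bullet> F p) / t\<^sup>2"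
    have G: "((\<lambda>u. v \<bullet> F u) has_derivative (\<lambda>k. v \<bullet> F' u k)) (at u)" if "u \<in> U" for u
      by (rule has_derivative_inner_right[OF F[OF that]])
    have lim: "(?q a b \<longlongrightarrow> v \<bullet> A b) (at_right 0)" "(?q b a \<longlongrightarrow> v \<bullet> B a) (at_right 0)"
      using second_difference_tendsto[where G = "\<lambda>u. v \<bullet> F u" and G' = "\<lambda>u k. v \<bullet> F' u k",
          OF U G has_derivative_inner_right[OF A], of b]
        second_difference_tendsto[where G = "\<lambda>u. v \<bullet> F u" and G' = "\<lambda>u k. v \<bullet> F' u k",
          OF U G has_derivative_inner_right[OF B], of a]
      by simp_all
    have "?q b a = ?q a b"
      by (intro ext) (simp add: ac_simps)
    with lim(2) have "(?q a b \<longlongrightarrow> v \<bullet> B a) (at_right 0)" by (simp only:)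
    with lim(1) show ?thesis by (rule tendsto_unique[OF trivial_limit_at_right_real])
  qed
  from eq[of "A b - B a"] have "(A b - B a) \<bullet> (A b - B a) = 0"
    by (simp add: inner_diff_right)
  then show ?thesis by simp
qed

text \<open>The differential of an immersion has a left inverse, so a continuous lift of a
  differentiable map through an immersion is differentiable.\<close>

lemma has_derivative_lift:
  fixes \<psi> :: "'b::real_normed_vector \<Rightarrow> 'c::real_normed_vector"
    and \<tau> :: "'a::real_normed_vector \<Rightarrow> 'b"
  assumes \<psi>: "(\<psi> has_derivative B) (at (\<tau> u))"
    and \<psi>\<tau>: "((\<lambda>v. \<psi> (\<tau> v)) has_derivative A) (at u)"
    and cont: "isCont \<tau> u"
    and C: "bounded_linear C" "\<And>w. C (B w) = w"
  shows "(\<tau> has_derivative (\<lambda>k. C (A k))) (at u)"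
proof -
  \<comment> \<open>Composition with the left inverse \<open>C\<close> reduces the claim to a map
    whose derivative at \<open>\<tau> u\<close> is the identity.\<close>
  define g where "g w = C (\<psi> w)" for w
  define D where "D k = C (A k)" for k
  have g: "(g has_derivative (\<lambda>w. w)) (at (\<tau> u))"
    using bounded_linear.has_derivative[OF C(1) \<psi>] unfolding g_def C(2) .
  have gt: "((\<lambda>v. g (\<tau> v)) has_derivative D) (at u)"
    using bounded_linear.has_derivative[OF C(1) \<psi>\<tau>] unfolding g_def D_def .
  interpret D: bounded_linear D using gt by (rule has_derivative_bounded_linear)
  obtain K where K: "K > 0" "\<And>k. norm (D k) \<le> norm k * K" using D.pos_bounded by blast
  have "(\<tau> has_derivative D) (at u)"
    unfolding has_derivative_at_alt
  proof (intro conjI allI impI)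
    fix e :: real assume e: "e > 0"
    \<comment> \<open>The bound 1/2 allows the term in |\<tau> v - \<tau> u| to be absorbed, which
      gives |\<tau> v - \<tau> u| \<le> (2K+1) |v - u|. The total error is then at most e' (2K+2) |v
      - u|, and the second bound keeps it below e |v - u|.\<close>
    define e' where "e' = min (1/2) (e / (2 * K + 3))"
    have e': "e' > 0" "e' \<le> 1/2" "e' \<le> e / (2 * K + 3)"
      using e K(1) unfolding e'_def by (simp, linarith, simp)
    from this(3) have e'e: "e' * (2 * K + 3) \<le> e" using K(1) by (simp add: pos_le_divide_eq)
    obtain d1 where d1: "d1 > 0" "\<And>w. norm (w - \<tau> u) < d1 \<Longrightarrow>
        norm (g w - g (\<tau> u) - (w - \<tau> u)) \<le> e' * norm (w - \<tau> u)"
      using g e'(1) unfolding has_derivative_at_alt by blast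
    obtain d2 where d2: "d2 > 0" "\<And>v. norm (v - u) < d2 \<Longrightarrow>
        norm (g (\<tau> v) - g (\<tau> u) - D (v - u)) \<le> e' * norm (v - u)"
      using gt e'(1) unfolding has_derivative_at_alt by blast
    obtain d3 where d3: "d3 > 0" "\<And>v. norm (v - u) < d3 \<Longrightarrow> norm (\<tau> v - \<tau> u) < d1"
      using cont d1(1) unfolding continuous_at_eps_delta dist_norm by blast
    show "\<exists>d>0. \<forall>v. norm (v - u) < d \<longrightarrow> norm (\<tau> v - \<tau> u - D (v - u)) \<le> e * norm (v - u)"
    proof (intro exI[of _ "min d2 d3"] conjI allI impI)
      show "min d2 d3 > 0" using d2 d3 by simp
    next
      fix v assume v: "norm (v - u) < min d2 d3"
      let ?n = "norm (v - u)" and ?m = "norm (\<tau> v - \<tau> u)"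
      have r: "norm (g (\<tau> v) - g (\<tau> u) - (\<tau> v - \<tau> u)) \<le> e' * ?m"
        "norm (g (\<tau> v) - g (\<tau> u) - D (v - u)) \<le> e' * ?n"
        using d1(2) d2(2) d3(2) v by auto
      have "norm (\<tau> v - \<tau> u - D (v - u)) =
          norm ((g (\<tau> v) - g (\<tau> u) - D (v - u)) - (g (\<tau> v) - g (\<tau> u) - (\<tau> v - \<tau> u)))"
        by (simp add: algebra_simps)
      also have "\<dots> \<le> e' * ?n + e' * ?m"
        using r norm_triangle_ineq4 by (smt (verit))
      finally have 1: "norm (\<tau> v - \<tau> u - D (v - u)) \<le> e' * ?n + e' * ?m" .
      have "?m \<le> norm (\<tau> v - \<tau> u - D (v - u)) + norm (D (v - u))"
        using norm_triangle_ineq[of "\<tau> v - \<tau> u - D (v - u)" "D (v - u)"] by simp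
      also have "\<dots> \<le> (1/2) * ?n + (1/2) * ?m + ?n * K"
        using 1 K(2)[of "v - u"] mult_right_mono[OF e'(2), of ?n] mult_right_mono[OF e'(2), of ?m] by simp
      finally have m: "?m \<le> (2 * K + 1) * ?n" by (simp add: algebra_simps)
      have "e' * ?n + e' * ?m \<le> e' * ?n + e' * ((2 * K + 1) * ?n)"
        using m e' by (intro add_left_mono mult_left_mono) auto
      also have "\<dots> = (e' * (2 * K + 2)) * ?n" by (simp add: algebra_simps)
      also have "\<dots> \<le> (e' * (2 * K + 3)) * ?n"
        using e' by (intro mult_right_mono mult_left_mono) auto
      also have "\<dots> \<le> e * ?n" using e'e by (intro mult_right_mono) auto
      finally show "norm (\<tau> v - \<tau> u - D (v - u)) \<le> e * ?n" using 1 by linarith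
    qed
  qed (rule D.bounded_linear_axioms)
  then show ?thesis unfolding D_def .
qed

section \<open>Limits of vectors in varying subspaces\<close>

text \<open>An injective \<open>A0\<close> is bounded below by some m > 0. Once \<open>A i\<close>
  is within m/2 of \<open>A0\<close>, preimages of \<open>v i\<close> under \<open>A i\<close> have
  norm at most 2/m |v i|, so applying \<open>A0\<close> to them instead changes \<open>v i\<close>
  by an amount tending to 0. The limit is therefore a limit of points of the range of
  \<open>A0\<close>, which is closed.\<close>

lemma limit_in_range:
  fixes A :: "'i \<Rightarrow> 'a::euclidean_space \<Rightarrow> 'b::euclidean_space"
  assumes F: "F \<noteq> bot"
    and A: "\<forall>\<^sub>F i in F. linear (A i)" "linear A0" "inj A0"
    and conv: "\<And>b. b \<in> Basis \<Longrightarrow> ((\<lambda>i. A i b) \<longlongrightarrow> A0 b) F"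
    and v: "(v \<longlongrightarrow> l) F" "\<forall>\<^sub>F i in F. v i \<in> range (A i)"
  shows "l \<in> range A0"
proof -
  obtain m where m: "m > 0" "\<And>c. m * norm c \<le> norm (A0 c)"
    using linear_inj_bounded_below_pos[OF A(2,3)] by blast
  \<comment> \<open>A bound for the operator norm of the difference of \<open>A i\<close> and
    \<open>A0\<close>; it tends to 0 by convergence on the finite basis.\<close>
  define \<epsilon> where "\<epsilon> i = (\<Sum>b\<in>Basis. norm (A i b - A0 b))" for i
  have "(\<epsilon> \<longlongrightarrow> (\<Sum>b\<in>(Basis::'a set). norm (A0 b - A0 b))) F"
    unfolding \<epsilon>_def by (intro tendsto_intros conv)
  then have \<epsilon>: "(\<epsilon> \<longlongrightarrow> 0) F" by simp
  define c where "c i = (SOME c. v i = A i c)" for i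
  have c: "\<forall>\<^sub>F i in F. v i = A i (c i)"
    using v(2)
  proof eventually_elim
    case (elim i)
    then have "\<exists>c. v i = A i c" by blast
    then show ?case unfolding c_def by (rule someI_ex)
  qed
  have bound: "\<forall>\<^sub>F i in F. norm (A0 (c i) - v i) \<le> norm (\<epsilon> i) * (2 / m * norm (v i))"
    using c A(1) order_tendstoD(2)[OF \<epsilon>, of "m / 2", OF half_gt_zero[OF m(1)]]
  proof eventually_elim
    case (elim i)
    define L where "L w = A i w - A0 w" for w
    have L: "linear L" unfolding L_def using elim(2) A(2) by (rule linear_compose_sub)
    have "L (c i) = L (\<Sum>b\<in>Basis. (c i \<bullet> b) *\<^sub>R b)" by (simp add: euclidean_representation)
    also have "\<dots> = (\<Sum>b\<in>Basis. (c i \<bullet> b) *\<^sub>R L b)"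
      by (simp add: linear_sum[OF L] linear_scale[OF L])
    finally have "norm (L (c i)) \<le> (\<Sum>b\<in>Basis. norm (c i) * norm (L b))"
      by (auto intro!: sum_norm_le mult_right_mono simp: Basis_le_norm)
    also have "\<dots> = norm (c i) * \<epsilon> i" unfolding \<epsilon>_def L_def by (simp add: sum_distrib_left)
    finally have 1: "norm (A0 (c i) - v i) \<le> norm (c i) * \<epsilon> i"
      unfolding L_def elim(1) by (simp add: norm_minus_commute)
    have pos: "\<epsilon> i \<ge> 0" unfolding \<epsilon>_def by (simp add: sum_nonneg)
    have "m * norm (c i) \<le> norm (A0 (c i))" by (rule m)
    also have "\<dots> \<le> norm (v i) + norm (c i) * \<epsilon> i"
      using 1 norm_triangle_sub[of "A0 (c i)" "v i"] by linarith
    also have "\<dots> \<le> norm (v i) + norm (c i) * (m / 2)"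
      using elim(3) by (intro add_left_mono mult_left_mono) auto
    finally have "norm (c i) \<le> 2 / m * norm (v i)"
      using m(1) by (simp add: field_simps)
    then have "norm (c i) * \<epsilon> i \<le> (2 / m * norm (v i)) * \<epsilon> i"
      using pos by (rule mult_right_mono)
    then show ?case using 1 pos by (simp add: mult.commute)
  qed
  have "((\<lambda>i. norm (\<epsilon> i) * (2 / m * norm (v i))) \<longlongrightarrow> norm (0::real) * (2 / m * norm l)) F"
    by (intro tendsto_intros \<epsilon> v)
  then have "((\<lambda>i. norm (\<epsilon> i) * (2 / m * norm (v i))) \<longlongrightarrow> 0) F" by simp
  then have "((\<lambda>i. A0 (c i) - v i) \<longlongrightarrow> 0) F"
    by (rule Lim_null_comparison[OF bound])
  from tendsto_add[OF this v(1)] have lim: "((\<lambda>i. A0 (c i)) \<longlongrightarrow> l) F" by simp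
  have "closed (range A0)"
    by (intro closed_subspace linear_subspace_image A(2) subspace_UNIV)
  then show ?thesis
    by (rule Lim_in_closed_set[OF _ _ F lim]) simp
qed

section \<open>Calculus of smooth maps\<close>

lemma Ck_on_cong:
  assumes "open U" "\<And>u. u \<in> U \<Longrightarrow> F u = G u" "Ck_on k U F"
  shows "Ck_on k U G"
  using assms(2,3)
proof (induction k arbitrary: F G)
  case 0
  then show ?case by (simp cong: continuous_on_cong)
next
  case (Suc k)
  have diff: "F differentiable (at u)" if "u \<in> U" for u using Suc.prems(2) that by simp
  have eq: "frechet_derivative F (at u) = frechet_derivative G (at u)" if "u \<in> U" for u
    by (rule frechet_derivative_transform_within_open[OF diff[OF that] assms(1) that Suc.prems(1)])
  have "G differentiable (at u)" if "u \<in> U" for u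
  proof -
    have "(G has_derivative frechet_derivative F (at u)) (at u)"
      by (rule has_derivative_transform_within_open[OF _ assms(1) that Suc.prems(1)])
        (use diff[OF that] in \<open>simp_all add: frechet_derivative_works\<close>)
    then show ?thesis by (rule differentiableI)
  qed
  moreover have "Ck_on k U (\<lambda>u. frechet_derivative G (at u) a)" for a
    by (rule Suc.IH[of "\<lambda>u. frechet_derivative F (at u) a"]) (use eq Suc.prems(2) in auto)
  ultimately show ?case by simp
qed

lemma smooth_on_cong:
  "open U \<Longrightarrow> (\<And>u. u \<in> U \<Longrightarrow> F u = G u) \<Longrightarrow> smooth_on U F \<Longrightarrow> smooth_on U G"
  unfolding smooth_on_def using Ck_on_cong by blast

lemma smooth_on_has_derivative:
  "smooth_on U F \<Longrightarrow> u \<in> U \<Longrightarrow> (F has_derivative frechet_derivative F (at u)) (at u)"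
  unfolding smooth_on_def frechet_derivative_works[symmetric] by (metis Ck_on.simps(2))

lemma smooth_on_frechet_derivative:
  "smooth_on U F \<Longrightarrow> smooth_on U (\<lambda>u. frechet_derivative F (at u) a)"
  unfolding smooth_on_def by (metis Ck_on.simps(2))

lemma smooth_on_second_derivative_symmetric:
  fixes F :: "'a::euclidean_space \<Rightarrow> 'b::real_inner"
  assumes "open U" "u \<in> U" "smooth_on U F"
  shows "frechet_derivative (\<lambda>u. frechet_derivative F (at u) a) (at u) b =
    frechet_derivative (\<lambda>u. frechet_derivative F (at u) b) (at u) a"
proof -
  have F: "(F has_derivative frechet_derivative F (at v)) (at v)" if "v \<in> U" for v
    using assms(3) that by (rule smooth_on_has_derivative)
  have F': "((\<lambda>u. frechet_derivative F (at u) c) has_derivative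
      frechet_derivative (\<lambda>u. frechet_derivative F (at u) c) (at u)) (at u)" for c
    by (rule smooth_on_has_derivative[OF smooth_on_frechet_derivative[OF assms(3)] assms(2)])
  show ?thesis
    by (rule second_derivative_symmetric[where F = F and F' = "\<lambda>u. frechet_derivative F (at u)"
        and A = "frechet_derivative (\<lambda>u. frechet_derivative F (at u) a) (at u)"
        and B = "frechet_derivative (\<lambda>u. frechet_derivative F (at u) b) (at u)",
        OF assms(1,2) F F' F'])
qed

section \<open>Change of parametrization\<close>

lemma local_parametrizationD:
  assumes "local_parametrization M f U x"
  shows "open U" "openin (top_of_set M) (x ` U)" "smooth_on U (f \<circ> x)" "continuous_on U x"
    "inj_on x U" "u \<in> U \<Longrightarrow> inj (frechet_derivative (f \<circ> x) (at u))"
    "u \<in> U \<Longrightarrow> linear (frechet_derivative (f \<circ> x) (at u))"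
proof -
  show "smooth_on U (f \<circ> x)" using assms by (simp add: local_parametrization_def)
  then show "u \<in> U \<Longrightarrow> linear (frechet_derivative (f \<circ> x) (at u))"
    by (rule has_derivative_linear[OF smooth_on_has_derivative])
  show "inj_on x U"
    using assms unfolding local_parametrization_def by (metis homeomorphism_apply1 inj_on_inverseI)
qed (use assms in \<open>auto simp: local_parametrization_def homeomorphism_def\<close>)

lemma open_parametrization_preimage:
  assumes x: "local_parametrization M f U x" and V: "openin (top_of_set M) V"
  shows "open {u \<in> U. x u \<in> V}"
proof -
  have "x ` U \<subseteq> M" using local_parametrizationD(2)[OF x] openin_subset by fastforce
  then have "openin (top_of_set U) (U \<inter> x -` V)"
    using continuous_openin_preimage[OF local_parametrizationD(4)[OF x] _ V, of] by blast
  then have "open (U \<inter> x -` V)" using local_parametrizationD(1)[OF x] openin_open_trans by blast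
  moreover have "{u \<in> U. x u \<in> V} = U \<inter> x -` V" by auto
  ultimately show ?thesis by simp
qed

text \<open>\<open>T\<close> is the differential at \<open>u\<close> of the transition map from
  \<open>x\<close> to \<open>x'\<close>. This map is continuous, and its composition with the
  immersion \<open>f \<circ> x'\<close> is \<open>f \<circ> x\<close>, so
  \<open>has_derivative_lift\<close> makes it differentiable. The rest is the chain rule, with one
  \<open>T\<close> serving \<open>f\<close> and all fields \<open>W\<close>.\<close>

lemma parametrization_change:
  fixes f :: "'p::t2_space \<Rightarrow> 'n::finite affine_space"
  assumes x: "local_parametrization M f U x" "u \<in> U"
    and x': "local_parametrization M f U' x'" "u' \<in> U'"
    and p: "x u = x' u'"
  obtains T where
    "frechet_derivative (f \<circ> x) (at u) = (\<lambda>a. frechet_derivative (f \<circ> x') (at u') (T a))"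
    "\<And>(W :: 'p \<Rightarrow> 'n affine_space) D.
       (W \<circ> x' has_derivative D) (at u') \<Longrightarrow> (W \<circ> x has_derivative (\<lambda>a. D (T a))) (at u)"
proof -
  obtain y' where y': "homeomorphism U' (x' ` U') x' y'"
    using x'(1) unfolding local_parametrization_def by blast
  define N where "N = {v \<in> U. x v \<in> x' ` U'}"
  have N: "open N" unfolding N_def
    by (rule open_parametrization_preimage[OF x(1) local_parametrizationD(2)[OF x'(1)]])
  have uN: "u \<in> N" unfolding N_def using x(2) x'(2) p by auto
  \<comment> \<open>The transition map, well behaved on the open set \<open>N\<close> of parameters
    whose image lies in both patches.\<close>
  define \<tau> where "\<tau> v = y' (x v)" for v
  have x\<tau>: "x' (\<tau> v) = x v" if "v \<in> N" for v
    using that homeomorphism_apply2[OF y'] unfolding N_def \<tau>_def by auto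
  have \<tau>u: "\<tau> u = u'" unfolding \<tau>_def p using homeomorphism_apply1[OF y' x'(2)] .
  have "continuous_on N \<tau>"
    unfolding \<tau>_def
    by (rule continuous_on_compose2[OF homeomorphism_cont2[OF y'] continuous_on_subset[OF local_parametrizationD(4)[OF x(1)]]])
      (auto simp: N_def)
  then have cont: "isCont \<tau> u" using N uN continuous_on_eq_continuous_at by blast
  let ?A = "frechet_derivative (f \<circ> x) (at u)" and ?B = "frechet_derivative (f \<circ> x') (at u')"
  have A: "(f \<circ> x has_derivative ?A) (at u)"
    by (rule smooth_on_has_derivative[OF local_parametrizationD(3)[OF x(1)] x(2)])
  have B: "(f \<circ> x' has_derivative ?B) (at (\<tau> u))"
    unfolding \<tau>u by (rule smooth_on_has_derivative[OF local_parametrizationD(3)[OF x'(1)] x'(2)])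
  obtain C where C: "linear C" "C \<circ> ?B = id"
    using linear_injective_left_inverse[OF local_parametrizationD(7)[OF x'] local_parametrizationD(6)[OF x']]
    by blast
  have A': "((\<lambda>v. (f \<circ> x') (\<tau> v)) has_derivative ?A) (at u)"
    by (rule has_derivative_transform_within_open[OF A N uN]) (simp add: x\<tau>)
  have T: "(\<tau> has_derivative (\<lambda>k. C (?A k))) (at u)"
    by (rule has_derivative_lift[OF B A' cont]) (use C in \<open>auto simp: linear_conv_bounded_linear fun_eq_iff\<close>)
  have lift: "(W \<circ> x has_derivative (\<lambda>a. D (C (?A a)))) (at u)"
    if "(W \<circ> x' has_derivative D) (at u')" for W :: "'p \<Rightarrow> 'n affine_space" and D
  proof -
    have "((\<lambda>v. (W \<circ> x') (\<tau> v)) has_derivative (\<lambda>a. D (C (?A a)))) (at u)"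
      by (rule has_derivative_compose[OF T]) (use that \<tau>u in \<open>simp add: o_def\<close>)
    then show ?thesis
      by (rule has_derivative_transform_within_open[OF _ N uN]) (simp add: x\<tau>)
  qed
  \<comment> \<open>The chain rule for the field \<open>W = f\<close>, combined with uniqueness of
    derivatives.\<close>
  have "?A = (\<lambda>a. ?B (C (?A a)))"
    by (rule has_derivative_unique[OF A lift]) (use B in \<open>simp only: \<tau>u\<close>)
  then show thesis using lift by (rule that)
qed

section \<open>Independence of the parametrization\<close>

text \<open>By \<open>parametrization_change\<close> the differential in any other parametrization
  factors through the one in \<open>x\<close>, so the union in the definition collapses to a single
  range.\<close>

lemma tangent_space_eq:
  assumes x: "local_parametrization M f U x" "u \<in> U"
  shows "tangent_space M f (x u) = range (frechet_derivative (f \<circ> x) (at u))"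
proof -
  have "range (frechet_derivative (f \<circ> x') (at u')) \<subseteq> range (frechet_derivative (f \<circ> x) (at u))"
    if x': "local_parametrization M f U' x'" "u' \<in> U'" and "x' u' = x u" for U' x' u'
    using parametrization_change[OF x' x \<open>x' u' = x u\<close>] by (smt (verit) image_subset_iff rangeI)
  then show ?thesis unfolding tangent_space_def using x by blast
qed

text \<open>This makes the definite description well defined. In another parametrization both
  differentials acquire the same factor \<open>T\<close>, and injectivity of the differential of
  \<open>f \<circ> x\<close> forces \<open>T a' = a\<close>.\<close>

lemma flat_derivative_eq:
  assumes x: "local_parametrization M f U x" "u \<in> U"
    and D: "(W \<circ> x has_derivative D) (at u)"
  shows "flat_derivative M f W (x u) (frechet_derivative (f \<circ> x) (at u) a) = D a"
  unfolding flat_derivative_def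
proof (rule the_equality)
  show "\<exists>U' x' u' a'. local_parametrization M f U' x' \<and> u' \<in> U' \<and> x' u' = x u \<and>
      frechet_derivative (f \<circ> x') (at u') a' = frechet_derivative (f \<circ> x) (at u) a \<and>
      frechet_derivative (W \<circ> x') (at u') a' = D a"
    using x frechet_derivative_at[OF D] by metis
next
  fix w
  assume "\<exists>U' x' u' a'. local_parametrization M f U' x' \<and> u' \<in> U' \<and> x' u' = x u \<and>
      frechet_derivative (f \<circ> x') (at u') a' = frechet_derivative (f \<circ> x) (at u) a \<and>
      frechet_derivative (W \<circ> x') (at u') a' = w"
  then obtain U' x' u' a' where x': "local_parametrization M f U' x'" "u' \<in> U'" "x' u' = x u"
    and a': "frechet_derivative (f \<circ> x') (at u') a' = frechet_derivative (f \<circ> x) (at u) a"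
    and w: "frechet_derivative (W \<circ> x') (at u') a' = w" by blast
  obtain T where T: "frechet_derivative (f \<circ> x') (at u') = (\<lambda>a. frechet_derivative (f \<circ> x) (at u) (T a))"
    "(W \<circ> x' has_derivative (\<lambda>a. D (T a))) (at u')"
    using parametrization_change[OF x'(1,2) x x'(3)] D by metis
  have "T a' = a" using a' T(1) local_parametrizationD(6)[OF x] by (simp add: inj_eq)
  then show "w = D a" using w frechet_derivative_at[OF T(2)] by metis
qed

text \<open>Transfers differentiability from the parametrization that witnesses smoothness to an
  arbitrary one around the same point.\<close>

lemma smooth_along_has_derivative:
  assumes W: "smooth_along M f V W" and x: "local_parametrization M f U x" "u \<in> U" "x u \<in> V"
  shows "(W \<circ> x has_derivative frechet_derivative (W \<circ> x) (at u)) (at u)"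
proof -
  obtain U' x' u' where x': "local_parametrization M f U' x'" "u' \<in> U'" "x u = x' u'"
    and s: "smooth_on U' (W \<circ> x')"
    using W x(3) unfolding smooth_along_def by blast
  have "W \<circ> x differentiable (at u)"
    using parametrization_change[OF x(1,2) x'] smooth_on_has_derivative[OF s x'(2)]
    by (metis differentiableI)
  then show ?thesis by (simp add: frechet_derivative_works)
qed

section \<open>Fundamental form and shape operator in a parametrization\<close>

text \<open>Fields given in coordinates become fields on the patch by composing with the inverse of
  the injective \<open>x\<close>. This supplies the extensions over which the affine fundamental
  form quantifies.\<close>

lemma tangent_field_of_parametrization:
  assumes x: "local_parametrization M f U x" and F: "smooth_on U F"
    and tan: "\<And>u. u \<in> U \<Longrightarrow> F u \<in> tangent_space M f (x u)"
  obtains W where "tangent_field M f (x ` U) W" "\<And>u. u \<in> U \<Longrightarrow> W (x u) = F u"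
proof
  let ?W = "\<lambda>q. F (inv_into U x q)"
  show eq: "?W (x u) = F u" if "u \<in> U" for u
    using that local_parametrizationD(5)[OF x] by simp
  have "smooth_on U (?W \<circ> x)"
    by (rule smooth_on_cong[OF local_parametrizationD(1)[OF x] _ F]) (simp add: eq)
  then show "tangent_field M f (x ` U) ?W"
    unfolding tangent_field_def smooth_along_def using x local_parametrizationD(2)[OF x] tan eq by auto
qed

text \<open>Difference quotients of a tangent field vanishing at the point are tangent vectors at
  nearby points, so their limit is tangent.\<close>

lemma has_derivative_tangent:
  assumes x: "local_parametrization M f U x" "u \<in> U"
    and N: "open N" "u \<in> N" "N \<subseteq> U"
    and Z: "(Z has_derivative D) (at u)" "Z u = 0"
      "\<And>v. v \<in> N \<Longrightarrow> Z v \<in> tangent_space M f (x v)"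
  shows "D a \<in> tangent_space M f (x u)"
  unfolding tangent_space_eq[OF x]
proof (rule limit_in_range)
  let ?A = "\<lambda>v. frechet_derivative (f \<circ> x) (at v)" and ?c = "\<lambda>t::real. u + t *\<^sub>R a"
  show "linear (?A u)" "inj (?A u)" by (rule local_parametrizationD[OF x(1)] x(2))+
  have c: "(?c \<longlongrightarrow> u) (at 0)"
    by (rule tendsto_eq_intros refl)+ simp
  then have evN: "\<forall>\<^sub>F t in at 0. ?c t \<in> N" using N(1,2) by (rule topological_tendstoD)
  then show "\<forall>\<^sub>F t in at 0. linear (?A (?c t))"
    by (rule eventually_mono) (use local_parametrizationD(7)[OF x(1)] N(3) in blast)
  show "((\<lambda>t. ?A (?c t) b) \<longlongrightarrow> ?A u b) (at 0)" for b
  proof -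
    have "isCont (\<lambda>v. ?A v b) u"
      by (rule has_derivative_continuous, rule smooth_on_has_derivative[OF _ x(2)],
          rule smooth_on_frechet_derivative, rule local_parametrizationD(3)[OF x(1)])
    then show ?thesis using c by (rule isCont_tendsto_compose)
  qed
  show "\<forall>\<^sub>F t in at 0. Z (?c t) /\<^sub>R t \<in> range (?A (?c t))"
    using evN
  proof (rule eventually_mono)
    fix t assume t: "?c t \<in> N"
    then have cU: "?c t \<in> U" using N(3) by blast
    have "subspace (range (?A (?c t)))"
      by (intro linear_subspace_image local_parametrizationD(7)[OF x(1) cU] subspace_UNIV)
    moreover have "Z (?c t) \<in> range (?A (?c t))"
      using Z(3)[OF t] unfolding tangent_space_eq[OF x(1) cU] .
    ultimately show "Z (?c t) /\<^sub>R t \<in> range (?A (?c t))" by (rule subspace_scale)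
  qed
  have "((\<lambda>t. Z (?c t)) has_derivative (\<lambda>t. D (t *\<^sub>R a))) (at 0)"
    by (rule has_derivative_compose[where f = ?c]) (auto intro!: derivative_eq_intros Z(1))
  then have "((\<lambda>t. Z (?c t)) has_vector_derivative D a) (at 0)"
    unfolding has_vector_derivative_def
    using linear_scale[OF has_derivative_linear[OF Z(1)]] by simp
  then have lim: "((\<lambda>t. norm (Z (?c t) - t *\<^sub>R D a) / norm t) \<longlongrightarrow> 0) (at 0)"
    using Z(2) by (simp add: has_vector_derivative_def has_derivative_at)
  have "((\<lambda>t. norm (Z (?c t) /\<^sub>R t - D a)) \<longlongrightarrow> 0) (at 0)"
  proof (rule Lim_transform_eventually[OF lim], unfold eventually_at_filter, intro always_eventually allI impI)
    fix t :: real assume t: "t \<noteq> 0"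
    then have "Z (?c t) /\<^sub>R t - D a = (Z (?c t) - t *\<^sub>R D a) /\<^sub>R t"
      by (simp add: scaleR_diff_right)
    then show "norm (Z (?c t) - t *\<^sub>R D a) / norm t = norm (Z (?c t) /\<^sub>R t - D a)"
      by (simp add: divide_inverse_commute)
  qed
  then show "((\<lambda>t. Z (?c t) /\<^sub>R t) \<longlongrightarrow> D a) (at 0)"
    using Lim_null tendsto_norm_zero_iff by blast
qed simp

text \<open>The immersion makes the tangent space n-dimensional in a space of dimension n + 1. A
  conormal \<open>\<nu>\<close> turns membership in it into one scalar equation.\<close>

lemma tangent_space_hyperplane:
  fixes f :: "'p::t2_space \<Rightarrow> 'n::finite affine_space"
  assumes x: "local_parametrization M f U x" "u \<in> U"
  obtains \<nu> where "tangent_space M f (x u) = {v. \<nu> \<bullet> v = 0}"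
proof -
  let ?T = "tangent_space M f (x u)" and ?A = "frechet_derivative (f \<circ> x) (at u)"
  have A: "linear ?A" "inj ?A" by (rule local_parametrizationD[OF x(1)] x(2))+
  have T: "subspace ?T"
    unfolding tangent_space_eq[OF x] by (intro linear_subspace_image A subspace_UNIV)
  have "dim ?T = dim (UNIV :: (real^'n) set)"
    unfolding tangent_space_eq[OF x] by (rule dim_image_eq[OF A(1)]) (use A(2) in \<open>auto intro: inj_on_subset\<close>)
  also have "\<dots> = DIM('n affine_space) - 1" by (simp add: card_UNIV_option)
  finally obtain \<nu> where "span ?T = {v. \<nu> \<bullet> v = 0}" unfolding dim_eq_hyperplane by blast
  moreover have "span ?T = ?T" using T by (simp add: span_eq_iff)
  ultimately show thesis using that by blast
qed

text \<open>Pairing the Gauss formula with the conormal \<open>\<nu>\<close> kills the tangent part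
  and leaves a scalar equation that determines h(X,Y), since transversality gives
  \<open>\<nu> \<bullet> \<xi> (x u) \<noteq> 0\<close>.\<close>

lemma affine_fundamental_form_gauss:
  fixes f :: "'p::t2_space \<Rightarrow> 'n::finite affine_space"
  assumes x: "local_parametrization M f U x" "u \<in> U"
    and \<xi>: "\<xi> (x u) \<notin> tangent_space M f (x u)"
    and F: "smooth_on U F" "\<And>v. v \<in> U \<Longrightarrow> F v \<in> tangent_space M f (x v)"
    and \<nu>: "tangent_space M f (x u) = {v. \<nu> \<bullet> v = 0}"
  shows "affine_fundamental_form M f \<xi> (x u) (frechet_derivative (f \<circ> x) (at u) a) (F u) * (\<nu> \<bullet> \<xi> (x u)) =
    \<nu> \<bullet> frechet_derivative F (at u) a"
proof -
  let ?A = "frechet_derivative (f \<circ> x) (at u)" and ?D = "frechet_derivative F (at u)"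
  let ?T = "tangent_space M f (x u)"
  define c where "c = \<nu> \<bullet> ?D a / (\<nu> \<bullet> \<xi> (x u))"
  have nz: "\<nu> \<bullet> \<xi> (x u) \<noteq> 0" using \<xi> \<nu> by simp
  \<comment> \<open>Uniqueness needs at least one extension of the vector \<open>F u\<close>;
    without it the condition on the coefficient would be vacuous.\<close>
  obtain W0 where W0: "tangent_field M f (x ` U) W0" "\<And>v. v \<in> U \<Longrightarrow> W0 (x v) = F v"
    using tangent_field_of_parametrization[OF x(1) F] by blast
  have DF: "(F has_derivative ?D) (at u)" by (rule smooth_on_has_derivative[OF F(1) x(2)])
  \<comment> \<open>Any two extensions differ by a tangent field vanishing at the point. Its
    derivative there is tangent by \<open>has_derivative_tangent\<close>, so the
    \<open>\<nu>\<close>-component does not depend on the extension.\<close>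
  have flat: "\<nu> \<bullet> flat_derivative M f W (x u) (?A a) = \<nu> \<bullet> ?D a"
    if W: "tangent_field M f V W" "x u \<in> V" "W (x u) = F u" for V W
  proof -
    let ?E = "frechet_derivative (W \<circ> x) (at u)"
    have E: "(W \<circ> x has_derivative ?E) (at u)"
      by (rule smooth_along_has_derivative[OF _ x W(2)]) (use W(1) in \<open>simp add: tangent_field_def\<close>)
    have "openin (top_of_set M) V" using W(1) by (simp add: tangent_field_def)
    note N = open_parametrization_preimage[OF x(1) this]
    have "?E a - ?D a \<in> ?T"
    proof (rule has_derivative_tangent[OF x N, where Z = "\<lambda>v. (W \<circ> x) v - F v"])
      show "((\<lambda>v. (W \<circ> x) v - F v) has_derivative (\<lambda>a. ?E a - ?D a)) (at u)"
        by (rule has_derivative_diff[OF E DF])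
      fix v assume v: "v \<in> {u \<in> U. x u \<in> V}"
      then have "subspace (tangent_space M f (x v))"
        using tangent_space_eq[OF x(1), of v] local_parametrizationD(7)[OF x(1), of v]
        by (simp add: linear_subspace_image)
      moreover have "W (x v) \<in> tangent_space M f (x v)" "F v \<in> tangent_space M f (x v)"
        using W(1) v F(2) by (auto simp: tangent_field_def)
      ultimately show "(W \<circ> x) v - F v \<in> tangent_space M f (x v)"
        by (simp add: subspace_diff)
    qed (use x W in auto)
    then show ?thesis using flat_derivative_eq[OF x E] \<nu> by (simp add: inner_diff_right)
  qed
  have "affine_fundamental_form M f \<xi> (x u) (?A a) (F u) = c"
    unfolding affine_fundamental_form_def
  proof (rule the_equality)
    show "\<forall>V W. tangent_field M f V W \<and> x u \<in> V \<and> W (x u) = F u \<longrightarrow>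
        flat_derivative M f W (x u) (?A a) - c *\<^sub>R \<xi> (x u) \<in> ?T"
      using nz by (auto simp: \<nu> inner_diff_right flat c_def)
  next
    fix c'
    assume "\<forall>V W. tangent_field M f V W \<and> x u \<in> V \<and> W (x u) = F u \<longrightarrow>
        flat_derivative M f W (x u) (?A a) - c' *\<^sub>R \<xi> (x u) \<in> ?T"
    then have "flat_derivative M f W0 (x u) (?A a) - c' *\<^sub>R \<xi> (x u) \<in> ?T"
      using W0 x(2) by blast
    then have "\<nu> \<bullet> ?D a = c' * (\<nu> \<bullet> \<xi> (x u))"
      using flat[OF W0(1)] W0(2) x(2) by (simp add: \<nu> inner_diff_right)
    then show "c' = c" using nz by (simp add: c_def)
  qed
  then show ?thesis using nz by (simp add: c_def)
qed

text \<open>Up to the nonzero factor \<open>k\<close>, h on coordinate vectors is the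
  \<open>\<nu>\<close>-component of the second derivatives of \<open>f \<circ> x\<close>, and h(X, S
  Y) is minus that of the second derivatives of \<open>\<xi> \<circ> x\<close>. Linearity comes from
  the outer derivative, both symmetries from interchanging the derivatives.\<close>

lemma blaschke_structure:
  fixes f :: "'p::t2_space \<Rightarrow> 'n::finite affine_space"
  assumes hyp: "hypersurface M f" and trans: "transversal_field M f M \<xi>"
    and equi: "\<forall>p\<in>M. \<forall>X\<in>tangent_space M f p. flat_derivative M f \<xi> p X \<in> tangent_space M f p"
    and p: "p \<in> M"
  defines "V \<equiv> tangent_space M f p" and "h \<equiv> affine_fundamental_form M f \<xi> p"
    and "A \<equiv> shape_operator M f \<xi> p"
  shows "subspace V"
    and "\<And>X Y Z. X \<in> V \<Longrightarrow> Y \<in> V \<Longrightarrow> Z \<in> V \<Longrightarrow> h (X + Y) Z = h X Z + h Y Z"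
    and "\<And>X Z k. X \<in> V \<Longrightarrow> Z \<in> V \<Longrightarrow> h (k *\<^sub>R X) Z = k * h X Z"
    and "\<And>X Y. X \<in> V \<Longrightarrow> Y \<in> V \<Longrightarrow> h X Y = h Y X"
    and "\<And>X. X \<in> V \<Longrightarrow> A X \<in> V"
    and "\<And>X Y. X \<in> V \<Longrightarrow> Y \<in> V \<Longrightarrow> h X (A Y) = h Y (A X)"
proof -
  have \<xi>: "smooth_along M f M \<xi>" "\<And>q. q \<in> M \<Longrightarrow> \<xi> q \<notin> tangent_space M f q"
    using trans by (auto simp: transversal_field_def)
  \<comment> \<open>Taking the parametrization from the smoothness of \<open>\<xi>\<close> makes
    \<open>f \<circ> x\<close> and \<open>\<xi> \<circ> x\<close> smooth on the same
    \<open>U\<close>.\<close>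
  obtain U x u where x: "local_parametrization M f U x" "u \<in> U" and pu: "p = x u"
    and sm\<xi>: "smooth_on U (\<xi> \<circ> x)"
    using \<xi>(1) p unfolding smooth_along_def by blast
  have UM: "x v \<in> M" if "v \<in> U" for v
    using openin_subset[OF local_parametrizationD(2)[OF x(1)]] that by auto
  let ?A = "\<lambda>v. frechet_derivative (f \<circ> x) (at v)" and ?N = "\<lambda>v. frechet_derivative (\<xi> \<circ> x) (at v)"
  have V: "V = range (?A u)" unfolding V_def pu by (rule tangent_space_eq[OF x])
  have linA: "linear (?A u)" by (rule local_parametrizationD(7)[OF x])
  show sub: "subspace V" unfolding V by (intro linear_subspace_image linA subspace_UNIV)
  obtain \<nu> where \<nu>: "V = {v. \<nu> \<bullet> v = 0}"
    using tangent_space_hyperplane[OF x] unfolding V_def pu by blast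
  define k where "k = \<nu> \<bullet> \<xi> p"
  have k: "k \<noteq> 0" using \<xi>(2)[OF p] \<nu> unfolding V_def k_def by simp
  have gauss: "h (?A u a) (F u) * k = \<nu> \<bullet> frechet_derivative F (at u) a"
    if "smooth_on U F" "\<And>v. v \<in> U \<Longrightarrow> F v \<in> tangent_space M f (x v)" for F a
    unfolding h_def k_def pu
    by (rule affine_fundamental_form_gauss[OF x _ that]) (use \<xi>(2)[OF p] \<nu> in \<open>simp_all add: V_def pu\<close>)
  have smA: "smooth_on U (\<lambda>v. ?A v b)" for b
    by (rule smooth_on_frechet_derivative[OF local_parametrizationD(3)[OF x(1)]])
  have smN: "smooth_on U (\<lambda>v. ?N v b)" for b
    by (rule smooth_on_frechet_derivative[OF sm\<xi>])
  have hA: "h (?A u a) (?A u b) * k = \<nu> \<bullet> frechet_derivative (\<lambda>v. ?A v b) (at u) a" for a b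
    by (rule gauss[OF smA]) (simp add: tangent_space_eq[OF x(1)])
  have flat: "flat_derivative M f \<xi> (x v) (?A v b) = ?N v b" if "v \<in> U" for v b
    by (rule flat_derivative_eq[OF x(1) that smooth_on_has_derivative[OF sm\<xi> that]])
  \<comment> \<open>Here the equiaffine condition enters: the derivatives of \<open>\<xi>\<close>
    form tangent fields, so the Gauss formula applies to them as well.\<close>
  have tanN: "?N v b \<in> tangent_space M f (x v)" if "v \<in> U" for v b
    using equi UM[OF that] tangent_space_eq[OF x(1) that] flat[OF that] by (metis rangeI)
  have hN: "h (?A u a) (?N u b) * k = \<nu> \<bullet> frechet_derivative (\<lambda>v. ?N v b) (at u) a" for a b
    by (rule gauss[OF smN tanN])
  have lin: "linear (\<lambda>a. frechet_derivative (\<lambda>v. ?A v b) (at u) a)" for b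
    by (rule has_derivative_linear[OF smooth_on_has_derivative[OF smA x(2)]])
  show "h (X + Y) Z = h X Z + h Y Z" if "X \<in> V" "Y \<in> V" "Z \<in> V" for X Y Z
  proof -
    obtain a b c where abc: "X = ?A u a" "Y = ?A u b" "Z = ?A u c" using \<open>X \<in> V\<close> \<open>Y \<in> V\<close> \<open>Z \<in> V\<close> V by auto
    have "h (?A u (a + b)) (?A u c) * k = (h (?A u a) (?A u c) + h (?A u b) (?A u c)) * k"
      unfolding distrib_right hA linear_add[OF lin] by (simp add: inner_add_right)
    then show ?thesis using k unfolding abc linear_add[OF linA, symmetric] by simp
  qed
  show "h (r *\<^sub>R X) Z = r * h X Z" if "X \<in> V" "Z \<in> V" for X Z r
  proof -
    obtain a c where abc: "X = ?A u a" "Z = ?A u c" using \<open>X \<in> V\<close> \<open>Z \<in> V\<close> V by auto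
    have "h (?A u (r *\<^sub>R a)) (?A u c) * k = (r * h (?A u a) (?A u c)) * k"
      unfolding mult.assoc hA linear_scale[OF lin] by simp
    then show ?thesis using k unfolding abc linear_scale[OF linA, symmetric] by simp
  qed
  note scale = this
  show sym: "h X Y = h Y X" if XY: "X \<in> V" "Y \<in> V" for X Y
  proof -
    obtain a b where ab: "X = ?A u a" "Y = ?A u b" using XY V by auto
    have "h X Y * k = h Y X * k"
      unfolding ab hA
      using smooth_on_second_derivative_symmetric[OF local_parametrizationD(1)[OF x(1)] x(2) local_parametrizationD(3)[OF x(1)]]
      by metis
    then show ?thesis using k by simp
  qed
  show tan: "A X \<in> V" if "X \<in> V" for X
    using equi p that subspace_neg[OF sub] unfolding A_def V_def shape_operator_def by auto
  have AN: "A (?A u b) = - ?N u b" for b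
    unfolding A_def shape_operator_def pu by (simp add: flat[OF x(2)])
  show "h X (A Y) = h Y (A X)" if XY: "X \<in> V" "Y \<in> V" for X Y
  proof -
    \<comment> \<open>Homogeneity is established in the first argument; symmetry carries it over to
      the second.\<close>
    have neg: "h X (- Z) = - h X Z" if "X \<in> V" "Z \<in> V" for X Z
      using scale[of Z X "-1"] sym[of X Z] sym[of X "- Z"] that subspace_neg[OF sub] by auto
    obtain a b where ab: "X = ?A u a" "Y = ?A u b" using XY V by auto
    have N: "?N u b \<in> V" for b using tanN[OF x(2)] by (simp add: V_def pu)
    have "h X (?N u b) * k = h Y (?N u a) * k"
      unfolding ab hN
      using smooth_on_second_derivative_symmetric[OF local_parametrizationD(1)[OF x(1)] x(2) sm\<xi>]
      by metis
    then have "h X (?N u b) = h Y (?N u a)" using k by simp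
    then have "h X (- ?N u b) = h Y (- ?N u a)" using neg[OF XY(1) N] neg[OF XY(2) N] by simp
    then show ?thesis unfolding AN[symmetric] ab .
  qed
qed

section \<open>Pseudosymmetry on one tangent space\<close>

text \<open>Pure linear algebra at a point, with \<open>T\<close> in the role of the
  Opozda-Verstraelen tensor and \<open>A\<close> in that of the shape operator.\<close>

lemma curvature_dot_eq_tachibana:
  fixes V :: "'v::real_vector set" and h :: "'v tensor2" and A :: "'v \<Rightarrow> 'v"
  assumes sub: "subspace V"
    and add: "\<And>X Y Z. X \<in> V \<Longrightarrow> Y \<in> V \<Longrightarrow> Z \<in> V \<Longrightarrow> h (X + Y) Z = h X Z + h Y Z"
    and scale: "\<And>X Z k. X \<in> V \<Longrightarrow> Z \<in> V \<Longrightarrow> h (k *\<^sub>R X) Z = k * h X Z"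
    and sym: "\<And>X Y. X \<in> V \<Longrightarrow> Y \<in> V \<Longrightarrow> h X Y = h Y X"
    and nondeg: "\<And>X. X \<in> V \<Longrightarrow> (\<And>Y. Y \<in> V \<Longrightarrow> h X Y = 0) \<Longrightarrow> X = 0"
    and A: "\<And>X. X \<in> V \<Longrightarrow> A X \<in> V"
    and adj: "\<And>X Y. X \<in> V \<Longrightarrow> Y \<in> V \<Longrightarrow> h X (A Y) = h Y (A X)"
    and quad: "\<And>X Y. X \<in> V \<Longrightarrow> Y \<in> V \<Longrightarrow> h X (A (A Y)) + l1 * h X (A Y) + l * h X Y = 0"
    and T: "\<And>X1 X2 X3 X4. T X1 X2 X3 X4 = h X1 (A X4) * h X2 (A X3) - h X1 (A X3) * h X2 (A X4)"
    and V: "X1 \<in> V" "X2 \<in> V" "X3 \<in> V" "X4 \<in> V" "X \<in> V" "Y \<in> V"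
  shows "curvature_dot V h T T X1 X2 X3 X4 X Y = l * tachibana h T X1 X2 X3 X4 X Y"
proof -
  define s where "s X Y = h X (A Y)" for X Y
  have comb: "a *\<^sub>R P - b *\<^sub>R Q \<in> V" if "P \<in> V" "Q \<in> V" for a b P Q
    using that sub by (simp add: subspace_diff subspace_scale)
  have lin: "h (a *\<^sub>R P - b *\<^sub>R Q) Z = a * h P Z - b * h Q Z" if "P \<in> V" "Q \<in> V" "Z \<in> V" for a b P Q Z
    using add[of "a *\<^sub>R P" "(-b) *\<^sub>R Q" Z] scale[of P Z a] scale[of Q Z "-b"] that
      subspace_scale[OF sub] subspace_neg[OF sub] by simp
  have ssym: "s P Q = s Q P" if "P \<in> V" "Q \<in> V" for P Q
    using adj that by (simp add: s_def)
  \<comment> \<open>The candidate for the curvature endomorphism of \<open>T\<close> at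
    \<open>X\<close>, \<open>Y\<close>. It takes values in \<open>V\<close> for every argument,
    being a combination of \<open>A X\<close> and \<open>A Y\<close>.\<close>
  define D where "D Z = s Y Z *\<^sub>R A X - s X Z *\<^sub>R A Y" for Z
  have DV: "D Z \<in> V" for Z unfolding D_def by (intro comb A V)
  have DT: "h (D Z) P = T X Y Z P" if P: "P \<in> V" for Z P
    using lin[OF A[OF V(5)] A[OF V(6)] P] sym[OF A P] adj P V
    by (simp add: D_def T s_def)
  have endo: "curvature_endo V h T X Y Z = D Z" for Z
    unfolding curvature_endo_def
  proof (rule the_equality)
    show "D Z \<in> V \<and> (\<forall>P\<in>V. h (D Z) P = T X Y Z P)" using DV DT by blast
  next
    fix W assume W: "W \<in> V \<and> (\<forall>P\<in>V. h W P = T X Y Z P)"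
    \<comment> \<open>Non-degeneracy of h makes the candidate the only solution.\<close>
    have "W - D Z = 0"
    proof (rule nondeg)
      show "W - D Z \<in> V" using W DV sub by (simp add: subspace_diff)
      show "h (W - D Z) P = 0" if "P \<in> V" for P
        using lin[of W "D Z" P 1 1] W DV DT that by simp
    qed
    then show "W = D Z" by simp
  qed
  \<comment> \<open>By self-adjointness the left side is the square of the shape form, which the
    quadratic relation expresses through \<open>s\<close> and \<open>h\<close>.\<close>
  have s2: "h (A P) (A Q) = - l1 * s P Q - l * h P Q" if "P \<in> V" "Q \<in> V" for P Q
    using quad[OF that] adj[OF A[OF that(1)] that(2)] adj[OF that(1) A[OF that(2)]] sym A that
    by (simp add: s_def)
  have sD: "s (D Z) P = s Y Z * (- l1 * s X P - l * h X P) - s X Z * (- l1 * s Y P - l * h Y P)"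
    if "P \<in> V" for Z P
    using lin[OF A[OF V(5)] A[OF V(6)] A[OF that]] s2 V that by (simp add: D_def s_def)
  define E where "E = wedge_endo h X Y"
  have EV: "E Z \<in> V" for Z unfolding E_def wedge_endo_def by (intro comb V)
  have sE: "s (E Z) P = h Y Z * s X P - h X Z * s Y P" if "P \<in> V" for Z P
    using lin[OF V(5) V(6) A[OF that]] by (simp add: E_def wedge_endo_def s_def)
  have T': "T P Q R U = s P U * s Q R - s P R * s Q U" for P Q R U by (simp add: T s_def)
  have DR: "s P (D Z) = s (D Z) P" "s P (E Z) = s (E Z) P" if "P \<in> V" for P Z
    using ssym that DV EV by auto
  show ?thesis
    \<comment> \<open>Each value \<open>s (D Z) P\<close> occurs together with
      \<open>s (D P) Z\<close> and the same cofactor. The \<open>l1\<close> part is antisymmetric in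
      Z and P and cancels; the symmetrized \<open>l\<close> part equals \<open>l\<close> times the
      symmetrized \<open>s (E Z) P\<close>.\<close>
    unfolding curvature_dot_def tachibana_def derivation_action_def endo E_def[symmetric] T'
    using V by (simp add: DR sD sE ssym[OF V(1) V(5)] ssym[OF V(2) V(5)] ssym[OF V(3) V(5)] ssym[OF V(4) V(5)]
        ssym[OF V(1) V(6)] ssym[OF V(2) V(6)] ssym[OF V(3) V(6)] ssym[OF V(4) V(6)]) argo
qed

theorem theorem6p3:
  fixes M :: "'p::t2_space set"
    and f :: "'p \<Rightarrow> 'n::finite affine_space"
    and \<xi> :: "'p \<Rightarrow> 'n affine_space"
    and L L\<^sub>1 :: "'p \<Rightarrow> real"
  assumes dim: "CARD('n) \<ge> 3"
    and hyp: "nondegenerate_hypersurface M f"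
    and normal: "affine_normal M f \<xi>"
    and quad: "\<forall>p\<in>M. \<forall>X\<in>tangent_space M f p. \<forall>Y\<in>tangent_space M f p.
       shape_form 2 M f \<xi> p X Y + L\<^sub>1 p * shape_form 1 M f \<xi> p X Y
         + L p * blaschke_metric M f \<xi> p X Y = 0"
  shows "\<forall>p\<in>M. \<forall>X1\<in>tangent_space M f p. \<forall>X2\<in>tangent_space M f p.
       \<forall>X3\<in>tangent_space M f p. \<forall>X4\<in>tangent_space M f p.
       \<forall>X\<in>tangent_space M f p. \<forall>Y\<in>tangent_space M f p.
       curvature_dot (tangent_space M f p) (blaschke_metric M f \<xi> p)
           (opozda_verstraelen M f \<xi> p) (opozda_verstraelen M f \<xi> p) X1 X2 X3 X4 X Y
         = L p * tachibana (blaschke_metric M f \<xi> p) (opozda_verstraelen M f \<xi> p) X1 X2 X3 X4 X Y"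
proof (intro ballI)
  fix p X1 X2 X3 X4 X Y
  assume p: "p \<in> M"
    and V: "X1 \<in> tangent_space M f p" "X2 \<in> tangent_space M f p" "X3 \<in> tangent_space M f p"
      "X4 \<in> tangent_space M f p" "X \<in> tangent_space M f p" "Y \<in> tangent_space M f p"
  have hs: "hypersurface M f" and tr: "transversal_field M f M \<xi>"
    and eq: "\<forall>p\<in>M. \<forall>X\<in>tangent_space M f p. flat_derivative M f \<xi> p X \<in> tangent_space M f p"
    using hyp normal by (simp_all add: nondegenerate_hypersurface_def affine_normal_def)
  show "curvature_dot (tangent_space M f p) (blaschke_metric M f \<xi> p)
           (opozda_verstraelen M f \<xi> p) (opozda_verstraelen M f \<xi> p) X1 X2 X3 X4 X Y
         = L p * tachibana (blaschke_metric M f \<xi> p) (opozda_verstraelen M f \<xi> p) X1 X2 X3 X4 X Y"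
  \<comment> \<open>The claim is pointwise, so the two functions enter only as the constants
    \<open>L p\<close> and \<open>L\<^sub>1 p\<close>.\<close>
  proof (rule curvature_dot_eq_tachibana[where A = "shape_operator M f \<xi> p" and ?l1.0 = "L\<^sub>1 p"])
    fix X assume "X \<in> tangent_space M f p"
      "\<And>Y. Y \<in> tangent_space M f p \<Longrightarrow> blaschke_metric M f \<xi> p X Y = 0"
    then show "X = 0" using hyp tr p unfolding nondegenerate_hypersurface_def by blast
  next
    fix X Y assume "X \<in> tangent_space M f p" "Y \<in> tangent_space M f p"
    then show "blaschke_metric M f \<xi> p X (shape_operator M f \<xi> p (shape_operator M f \<xi> p Y)) +
        L\<^sub>1 p * blaschke_metric M f \<xi> p X (shape_operator M f \<xi> p Y) + L p * blaschke_metric M f \<xi> p X Y = 0"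
      using quad p by (simp add: shape_form_def numeral_2_eq_2)
  next
    show "opozda_verstraelen M f \<xi> p X1 X2 X3 X4 =
        blaschke_metric M f \<xi> p X1 (shape_operator M f \<xi> p X4) * blaschke_metric M f \<xi> p X2 (shape_operator M f \<xi> p X3) -
        blaschke_metric M f \<xi> p X1 (shape_operator M f \<xi> p X3) * blaschke_metric M f \<xi> p X2 (shape_operator M f \<xi> p X4)"
      for X1 X2 X3 X4
      by (simp add: opozda_verstraelen_def kulkarni_nomizu_def shape_form_def)
  qed (use V blaschke_structure[OF hs tr eq p] in auto)
qed

end
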